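(* Let $E$ be a nonzero real Banach space and let $h : E \times E^* \to\, ]-\infty,\infty]$ be proper and convex (not necessarily lower semicontinuous) such that $$h(x,x^* ) \ge \langle x, x^*\rangle \text{ for all } (x,x^* ) \in E \times E^* \quad\text{and}\quad h^*(y^*,y^{**}) \ge \langle y^*, y^{**}\rangle \text{ for all } (y^*,y^{**}) \in E^* \times E^{**}.$$ Then $h^@(x,x^* ) \ge \langle x, x^*\rangle$ for all $(x,x^* ) \in E \times E^*$, and the set $\{(x,x^* ) \in E \times E^* : h^@(x,x^* ) = \langle x, x^*\rangle\}$ is closed and quasidense in $E \times E^*$.
   Context: $E \times E^*$ is normed by $\|(x,x^* )\| := \sqrt{\|x\|^2 + \|x^*\|^2}$, and its dual is $E^* \times E^{**}$ under the pairing $\langle (x,x^* ), (y^*,y^{**})\rangle := \langle x, y^*\rangle + \langle x^*, y^{**}\rangle$. The Fenchel conjugate of $h$ is $h^*(y^*,y^{**}) := \sup_{(x,x^* ) \in E \times E^*}[\langle x, y^*\rangle + \langle x^*, y^{**}\rangle - h(x,x^* )]$. With $\widehat{x}$ the canonical image of $x \in E$ in $E^{**}$, the function $h^@$ on $E \times E^*$ is $h^@(x,x^* ) := h^*(x^*, \widehat{x}) = \sup_{(s,s^* ) \in E \times E^*}[\langle s, x^*\rangle + \langle x, s^*\rangle - h(s,s^* )]$. A subset $A \subset E \times E^*$ is quasidense (in $E \times E^*$) if, for all $(x,x^* ) \in E \times E^*$, $\inf_{(s,s^* ) \in A}\big[\frac12\|s-x\|^2 + \frac12\|s^*-x^*\|^2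 + \langle s-x, s^*-x^*\rangle\big] \le 0$. A function is proper if it is finite somewhere. *)

theory Defs
  imports "HOL-Analysis.Analysis"
begin

text \<open>
  The dual of \<open>E\<close> is the type \<open>E \<Rightarrow>\<^sub>L real\<close> of bounded linear functionals with the operator
  norm, and \<open>\<langle>x, x*\<rangle>\<close> is the application \<open>blinfun_apply x* x\<close>.  The library norm on
  \<open>E \<times> (E \<Rightarrow>\<^sub>L real)\<close> is \<open>sqrt (\<parallel>x\<parallel>\<^sup>2 + \<parallel>x*\<parallel>\<^sup>2)\<close>.
\<close>

text \<open>Only \<open>0 < t < 1\<close> is required, so that the convention \<open>0 * \<infinity> = 0\<close> of \<open>ereal\<close> plays no role.\<close>

definition convex_ereal :: "('v::real_vector \<Rightarrow> ereal) \<Rightarrow> bool" where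
  "convex_ereal f \<longleftrightarrow>
     (\<forall>u v. \<forall>t::real. 0 < t \<and> t < 1 \<longrightarrow>
        f ((1 - t) *\<^sub>R u + t *\<^sub>R v) \<le> ereal (1 - t) * f u + ereal t * f v)"

definition proper_ereal :: "('v \<Rightarrow> ereal) \<Rightarrow> bool" where
  "proper_ereal f \<longleftrightarrow> (\<exists>u. \<bar>f u\<bar> \<noteq> \<infinity>)"

definition fenchel_conj ::
  "('a::real_normed_vector \<times> ('a \<Rightarrow>\<^sub>L real) \<Rightarrow> ereal)
     \<Rightarrow> ('a \<Rightarrow>\<^sub>L real) \<times> (('a \<Rightarrow>\<^sub>L real) \<Rightarrow>\<^sub>L real) \<Rightarrow> ereal" where
  "fenchel_conj h = (\<lambda>(y', y''). SUP (x, x') \<in> UNIV.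
     ereal (blinfun_apply y' x + blinfun_apply y'' x') - h (x, x'))"

lift_definition bidual_embed :: "'a::real_normed_vector \<Rightarrow> (('a \<Rightarrow>\<^sub>L real) \<Rightarrow>\<^sub>L real)"
  is "\<lambda>x x'. blinfun_apply x' x"
  by (rule blinfun.bounded_linear_left)

definition conj_at ::
  "('a::real_normed_vector \<times> ('a \<Rightarrow>\<^sub>L real) \<Rightarrow> ereal) \<Rightarrow> 'a \<times> ('a \<Rightarrow>\<^sub>L real) \<Rightarrow> ereal" where
  "conj_at h = (\<lambda>(x, x'). fenchel_conj h (x', bidual_embed x))"

lemma conj_at_eq:
  "conj_at h (x, x') = (SUP (s, s') \<in> UNIV.
     ereal (blinfun_apply x' s + blinfun_apply s' x) - h (s, s'))"
  by (simp add: conj_at_def fenchel_conj_def bidual_embed.rep_eq)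

text \<open>The infimum is taken in \<open>ereal\<close>, so it is \<open>\<infinity>\<close> for \<open>A = {}\<close>; the empty set is not quasidense.\<close>

definition quasidense :: "('a::real_normed_vector \<times> ('a \<Rightarrow>\<^sub>L real)) set \<Rightarrow> bool" where
  "quasidense A \<longleftrightarrow>
     (\<forall>x x'. (INF (s, s') \<in> A.
        ereal (1/2 * (norm (s - x))\<^sup>2 + 1/2 * (norm (s' - x'))\<^sup>2 + blinfun_apply (s' - x') (s - x))) \<le> 0)"

end

theory Submission
  imports Defs
begin

text \<open>
  Write \<open>q (x, x*) = \<langle>x, x*\<rangle>\<close> (\<open>pairing\<close>) and \<open>r z = \<parallel>z\<parallel>\<^sup>2 / 2 + q z \<ge> 0\<close> (\<open>energy\<close>). The inequality
  \<open>h\<^sup>@ \<ge> q\<close> is the hypothesis on \<open>h*\<close> restricted to the canonical image of \<open>E\<close>. Hence the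
  coincidence set is \<open>{h\<^sup>@ \<le> q}\<close>, an intersection of closed sets, and only quasidensity is hard:
  near every point \<open>c\<close> in the sense of \<open>r\<close> there must be a point where \<open>h\<^sup>@ = q\<close>.

  Duality first gives approximate points (\<open>approximate_touching\<close>): for every \<open>c\<close> there is \<open>b\<close> for
  which both \<open>h b - q b\<close> and \<open>r (b - c)\<close> are small. Indeed \<open>h b - q b + r (b - c)\<close> is \<open>h b\<close> plus a
  continuous convex function of \<open>b\<close>, because the quadratic pairing terms cancel. If it were bounded
  below by a positive constant, an affine function would separate the two parts
  (\<open>convex_sandwich\<close>), and the hypothesis on \<open>h*\<close> excludes this. The separation rests on a
  Hahn--Banach theorem for convex functions, proved from Zorn's lemma through the linearity of
  minimal convex functions (\<open>minimal_convex_imp_linear\<close>).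

  Smallness of \<open>r (a - b)\<close> does not make \<open>a\<close> and \<open>b\<close> close in norm. But \<open>h \<ge> q\<close> at the midpoint gives
  \<open>- q (a - b) \<le> 2 ((h - q) a + (h - q) b)\<close> (\<open>minus_pairing_diff_le\<close>), and together the two bounds
  control \<open>\<parallel>a - b\<parallel>\<close>. So approximate points, each chosen near the previous one with geometrically
  decreasing tolerances, form a Cauchy sequence whose limit \<open>b\<close> is close in norm to the first of them
  (\<open>touching_point_near\<close>). For lack of lower semicontinuity \<open>h b\<close> itself is not controlled;
  instead the convexity of \<open>h\<close> along the sequence yields \<open>h\<^sup>@ b \<le> q b\<close>
  (\<open>touching_limit\<close>).

  The proofs work with the real-valued restriction \<open>H\<close> of \<open>h\<close> to its effective domain \<open>D\<close>.
\<close>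

section \<open>Subgradients of real-valued convex functions\<close>

text \<open>This bounds chains from below when Zorn's lemma is applied to convex functions.\<close>

lemma convex_on_UNIV_cINF:
  fixes C :: "('v::real_vector \<Rightarrow> real) set"
  assumes "C \<noteq> {}" and convex: "\<And>f. f \<in> C \<Longrightarrow> convex_on UNIV f"
    and bdd: "\<And>v. bdd_below ((\<lambda>f. f v) ` C)"
    and chain: "\<And>f g. f \<in> C \<Longrightarrow> g \<in> C \<Longrightarrow> f \<le> g \<or> g \<le> f"
  shows "convex_on UNIV (\<lambda>v. INF f\<in>C. f v)"
proof (rule convex_onI)
  fix t :: real and x y :: 'v
  assume t: "0 < t" "t < 1"
  let ?m = "\<lambda>v. INF f\<in>C. f v"
  show "?m ((1 - t) *\<^sub>R x + t *\<^sub>R y) \<le> (1 - t) * ?m x + t * ?m y"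
  proof (rule field_le_epsilon)
    fix e :: real assume "0 < e"
    obtain f where f: "f \<in> C" "f x < ?m x + e"
      using cINF_less_iff[OF \<open>C \<noteq> {}\<close> bdd, of x "?m x + e"] \<open>0 < e\<close> by auto
    obtain g where g: "g \<in> C" "g y < ?m y + e"
      using cINF_less_iff[OF \<open>C \<noteq> {}\<close> bdd, of y "?m y + e"] \<open>0 < e\<close> by auto
    \<comment> \<open>The smaller of the two functions serves both points.\<close>
    obtain k where k: "k \<in> C" "k \<le> f" "k \<le> g"
      using chain[OF f(1) g(1)] f(1) g(1) by auto
    have kx: "k x \<le> ?m x + e"
      using f(2) le_funD[OF k(2), of x] by linarith
    have ky: "k y \<le> ?m y + e"
      using g(2) le_funD[OF k(3), of y] by linarith
    have "?m ((1 - t) *\<^sub>R x + t *\<^sub>R y) \<le> k ((1 - t) *\<^sub>R x + t *\<^sub>R y)"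
      by (rule cINF_lower[OF bdd k(1)])
    also have "\<dots> \<le> (1 - t) * k x + t * k y"
      using convex_onD[OF convex[OF k(1)]] t by simp
    also have "\<dots> \<le> (1 - t) * (?m x + e) + t * (?m y + e)"
      using kx ky t by (intro add_mono mult_left_mono) auto
    also have "\<dots> = (1 - t) * ?m x + t * ?m y + e"
      by (simp add: algebra_simps)
    finally show "?m ((1 - t) *\<^sub>R x + t *\<^sub>R y) \<le> (1 - t) * ?m x + t * ?m y + e" .
  qed
qed simp

lemma convex_on_UNIV_compose_affine:
  fixes f :: "'v::real_vector \<Rightarrow> real"
  assumes "convex_on UNIV f"
  shows "convex_on UNIV (\<lambda>v. f (a + c *\<^sub>R v))"
proof (rule convex_onI)
  fix t :: real and x y :: 'v
  assume t: "0 < t" "t < 1"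
  have "a + c *\<^sub>R ((1 - t) *\<^sub>R x + t *\<^sub>R y)
      = (1 - t) *\<^sub>R (a + c *\<^sub>R x) + t *\<^sub>R (a + c *\<^sub>R y)"
    by (simp add: algebra_simps)
  then show "f (a + c *\<^sub>R ((1 - t) *\<^sub>R x + t *\<^sub>R y))
      \<le> (1 - t) * f (a + c *\<^sub>R x) + t * f (a + c *\<^sub>R y)"
    using convex_onD[OF assms, of t "a + c *\<^sub>R x" "a + c *\<^sub>R y"] t by simp
qed simp

lemma convex_on_UNIV_minus_le:
  fixes f :: "'v::real_vector \<Rightarrow> real"
  assumes "convex_on UNIV f" "f 0 = 0"
  shows "- f (- v) \<le> f v"
  using convex_onD[OF assms(1), of "1/2" v "- v"] assms(2) by simp

text \<open>
  Two convex competitors exploit minimality. For \<open>0 < t < 1\<close>, convexity and \<open>f 0 = 0\<close> make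
  \<open>f (t v) / t\<close> a competitor, so \<open>f\<close> is positively homogeneous, hence subadditive.
  Subadditivity then makes \<open>f (w + v) - f w\<close> a competitor, so \<open>f\<close> is additive.
\<close>

lemma minimal_convex_imp_linear:
  fixes f :: "'v::real_vector \<Rightarrow> real"
  assumes convex: "convex_on UNIV f" and "f 0 = 0"
    and minimal: "\<And>g. convex_on UNIV g \<Longrightarrow> g 0 = 0 \<Longrightarrow> (\<And>v. g v \<le> f v) \<Longrightarrow> g = f"
  shows "linear f"
proof -
  have scale: "f (t *\<^sub>R v) = t * f v" if t: "0 < t" "t < 1" for t v
  proof -
    have "(\<lambda>v. (1 / t) * f (0 + t *\<^sub>R v)) = f"
    proof (rule minimal)
      show "convex_on UNIV (\<lambda>v. (1 / t) * f (0 + t *\<^sub>R v))"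
        using t by (intro convex_on_cmul convex_on_UNIV_compose_affine convex) auto
      show "(1 / t) * f (0 + t *\<^sub>R v) \<le> f v" for v
        using convex_onD[OF convex, of t 0 v] t \<open>f 0 = 0\<close> by (simp add: field_simps)
    qed (simp add: \<open>f 0 = 0\<close>)
    from fun_cong[OF this, of v] show ?thesis
      using t by (simp add: field_simps)
  qed
  have subadd: "f (v + w) \<le> f v + f w" for v w
  proof -
    have "f (v + w) = 2 * f ((1/2) *\<^sub>R (v + w))"
      using scale[of "1/2" "v + w"] by simp
    also have "\<dots> \<le> f v + f w"
      using convex_onD[OF convex, of "1/2" v w] by (simp add: scaleR_add_right)
    finally show ?thesis .
  qed
  have add: "f (v + w) = f v + f w" for v w
  proof -
    have "(\<lambda>v. f (w + 1 *\<^sub>R v) + - f w) = f"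
    proof (rule minimal)
      show "convex_on UNIV (\<lambda>v. f (w + 1 *\<^sub>R v) + - f w)"
        by (rule convex_on_add[OF convex_on_UNIV_compose_affine[OF convex]])
          (simp add: convex_on_const)
      show "f (w + 1 *\<^sub>R v) + - f w \<le> f v" for v
        using subadd[of w v] by simp
    qed simp
    from fun_cong[OF this, of v] show ?thesis
      by (simp add: add.commute)
  qed
  have minus: "f (- v) = - f v" for v
    using add[of v "- v"] \<open>f 0 = 0\<close> by simp
  have pos: "f (t *\<^sub>R v) = t * f v" if t: "0 < t" for t v
  proof (cases "t < 1")
    case False
    then show ?thesis
      using scale[of "1 / t" "t *\<^sub>R v"] t by (cases "t = 1") (auto simp: field_simps)
  qed (use t scale in auto)
  have "f (t *\<^sub>R v) = t * f v" for t v
    using pos[of t v] pos[of "- t" v] minus[of "t *\<^sub>R v"] \<open>f 0 = 0\<close>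
    by (cases t "0::real" rule: linorder_cases) auto
  with add show ?thesis
    by (intro linearI) auto
qed

text \<open>
  An algebraic Hahn--Banach theorem: Zorn's lemma provides a minimal convex function below
  \<open>m - m 0\<close> that vanishes at the origin, and minimality makes it linear. Chains are bounded
  below pointwise because a convex function with \<open>f 0 = 0\<close> satisfies \<open>f v \<ge> - f (- v)\<close>.
\<close>

theorem convex_algebraic_subgradient:
  fixes m :: "'v::real_vector \<Rightarrow> real"
  assumes "convex_on UNIV m"
  obtains L where "linear L" "\<And>v. m 0 + L v \<le> m v"
proof -
  define n where "n = (\<lambda>v. m v + - m 0)"
  define A where "A = {f. convex_on UNIV f \<and> f 0 = 0 \<and> f \<le> n}"
  have "n \<in> A"
    unfolding A_def n_def using convex_on_add[OF assms, of "\<lambda>_. - m 0"]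
    by (simp add: convex_on_const)
  have "\<exists>f\<in>A. \<forall>g\<in>A. f \<ge> g \<longrightarrow> g = f"
  proof (rule predicate_Zorn)
    show "partial_order_on A (relation_of (\<ge>) A)"
      by (rule partial_order_on_relation_ofI) auto
  next
    fix C assume C: "C \<in> Chains (relation_of (\<ge>) A)"
    then have CA: "C \<subseteq> A" by (rule Chains_relation_of)
    show "\<exists>u\<in>A. \<forall>a\<in>C. a \<ge> u"
    proof (cases "C = {}")
      case True
      with \<open>n \<in> A\<close> show ?thesis by auto
    next
      case False
      have bdd: "bdd_below ((\<lambda>f. f v) ` C)" for v
      proof (rule bdd_belowI2)
        fix f assume "f \<in> C"
        with CA have f: "convex_on UNIV f" "f 0 = 0" "f (- v) \<le> n (- v)"
          by (auto simp: A_def le_fun_def)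
        then show "- n (- v) \<le> f v"
          using convex_on_UNIV_minus_le[of f v] by linarith
      qed
      define u where "u = (\<lambda>v. INF f\<in>C. f v)"
      have u_le: "u \<le> f" if "f \<in> C" for f
        unfolding u_def le_fun_def using cINF_lower[OF bdd that] by blast
      have "convex_on UNIV u"
        unfolding u_def
        using False CA C bdd by (intro convex_on_UNIV_cINF) (auto simp: A_def Chains_def relation_of_def)
      moreover have "u 0 = 0"
      proof -
        have "(\<lambda>f. f 0) ` C = {0}"
          using CA False by (auto simp: A_def)
        then show ?thesis by (simp add: u_def)
      qed
      moreover have "u \<le> n"
      proof -
        obtain f where "f \<in> C" using False by auto
        then have "u \<le> f" "f \<le> n" using CA u_le by (auto simp: A_def)
        then show ?thesis by (rule order_trans)
      qed
      ultimately show ?thesis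
        using u_le by (auto simp: A_def)
    qed
  qed
  then obtain f where f: "f \<in> A" and min: "\<And>g. g \<in> A \<Longrightarrow> g \<le> f \<Longrightarrow> g = f"
    by auto
  have "linear f"
  proof (rule minimal_convex_imp_linear)
    fix g assume "convex_on UNIV g" "g 0 = 0" "\<And>v. g v \<le> f v"
    then show "g = f"
      using f by (intro min) (auto simp: A_def le_fun_def intro: order_trans[of "g _" "f _"])
  qed (use f in \<open>auto simp: A_def\<close>)
  moreover have "m 0 + f v \<le> m v" for v
  proof -
    have "f v \<le> n v"
      using f by (simp add: A_def le_fun_def)
    then show ?thesis by (simp add: n_def)
  qed
  ultimately show ?thesis using that by blast
qed

section \<open>A sandwich theorem\<close>

lemma linear_bounded_above_imp_bounded_linear:
  fixes L :: "'v::real_normed_vector \<Rightarrow> real"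
  assumes "linear L" "0 < d" and le: "\<And>v. norm v \<le> d \<Longrightarrow> L v \<le> K"
  shows "bounded_linear L"
proof -
  have "norm (L v) \<le> norm v * (K / d)" for v
  proof (cases "v = 0")
    case True
    then show ?thesis using linear_0[OF \<open>linear L\<close>] by simp
  next
    case False
    let ?c = "d / norm v"
    have "norm (?c *\<^sub>R v) = d"
      using False \<open>0 < d\<close> by simp
    then have "?c * L v \<le> K" "- (?c * L v) \<le> K"
      using le[of "?c *\<^sub>R v"] le[of "- (?c *\<^sub>R v)"]
      by (simp_all add: linear_neg[OF \<open>linear L\<close>] linear_scale[OF \<open>linear L\<close>])
    then have "\<bar>?c * L v\<bar> \<le> K"
      by (rule abs_leI)
    then have "?c * \<bar>L v\<bar> \<le> K"
      using \<open>0 < d\<close> by (simp add: abs_mult)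
    then show ?thesis
      using False \<open>0 < d\<close> by (simp add: field_simps)
  qed
  then show ?thesis
    using linear_add[OF \<open>linear L\<close>] linear_scale[OF \<open>linear L\<close>]
    by (intro bounded_linear_intro[of L "K / d"]) auto
qed

text \<open>
  An affine function fits between \<open>- g\<close> and \<open>H\<close>. The infimal convolution
  \<open>m v = inf b. H b + g (b + v)\<close> is convex and real-valued, and
  \<open>m 0 \<ge> 0\<close>. A subgradient \<open>L\<close> of \<open>m\<close> at the origin satisfies \<open>L x - g x \<le> H b + L b\<close> for all
  \<open>x\<close> and all \<open>b\<close> in \<open>D\<close>, so the infimum of the right-hand sides separates. Since \<open>g\<close> is locally
  bounded, \<open>L\<close> is bounded above near the origin, hence continuous.
\<close>

theorem convex_sandwich:
  fixes H g :: "'v::real_normed_vector \<Rightarrow> real"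
  assumes H: "convex_on D H" and "D \<noteq> {}"
    and g: "convex_on UNIV g" "continuous_on UNIV g"
    and nonneg: "\<And>x. x \<in> D \<Longrightarrow> 0 \<le> H x + g x"
  obtains L :: "'v \<Rightarrow>\<^sub>L real" and a :: real
  where "\<And>x. x \<in> D \<Longrightarrow> L x + a \<le> H x" and "\<And>x. 0 \<le> L x + a + g x"
proof -
  obtain b0 where b0: "b0 \<in> D" using \<open>D \<noteq> {}\<close> by auto
  define m where "m v = (INF b\<in>D. H b + g (b + v))" for v
  have lower: "- (H b0 + g (b0 - v)) \<le> H b + g (b + v)" if b: "b \<in> D" for b v
  proof -
    \<comment> \<open>The arguments of \<open>H\<close> and \<open>g\<close> have the same midpoint, where the sum is nonnegative.\<close>
    define c where "c = (1 - 1/2) *\<^sub>R b + (1/2) *\<^sub>R b0"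
    have c': "c = (1 - 1/2) *\<^sub>R (b + v) + (1/2) *\<^sub>R (b0 - v)"
      by (simp add: c_def algebra_simps)
    have "c \<in> D"
      unfolding c_def by (rule convexD_alt[OF convex_on_imp_convex[OF H] b b0]) auto
    have "H c \<le> (1 - 1/2) * H b + 1/2 * H b0"
      unfolding c_def by (rule convex_onD[OF H]) (use b b0 in auto)
    moreover have "g c \<le> (1 - 1/2) * g (b + v) + 1/2 * g (b0 - v)"
      unfolding c' by (rule convex_onD[OF g(1)]) auto
    ultimately show ?thesis
      using nonneg[OF \<open>c \<in> D\<close>] by (simp add: field_simps)
  qed
  have bdd: "bdd_below ((\<lambda>b. H b + g (b + v)) ` D)" for v
    by (rule bdd_belowI2[OF lower])
  have m_le: "m v \<le> H b + g (b + v)" if "b \<in> D" for b v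
    unfolding m_def by (rule cINF_lower[OF bdd that])
  have "convex_on UNIV m"
  proof (rule convex_onI)
    fix t :: real and x y :: 'v
    assume t: "0 < t" "t < 1"
    show "m ((1 - t) *\<^sub>R x + t *\<^sub>R y) \<le> (1 - t) * m x + t * m y"
    proof (rule field_le_epsilon)
      fix e :: real assume "0 < e"
      obtain b where b: "b \<in> D" "H b + g (b + x) < m x + e"
        using cINF_less_iff[OF \<open>D \<noteq> {}\<close> bdd, of x "m x + e"] \<open>0 < e\<close> by (auto simp: m_def)
      obtain c where c: "c \<in> D" "H c + g (c + y) < m y + e"
        using cINF_less_iff[OF \<open>D \<noteq> {}\<close> bdd, of y "m y + e"] \<open>0 < e\<close> by (auto simp: m_def)
      let ?d = "(1 - t) *\<^sub>R b + t *\<^sub>R c"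
      have "?d \<in> D"
        using convex_on_imp_convex[OF H] b(1) c(1) t unfolding convex_alt by simp
      have eq: "?d + ((1 - t) *\<^sub>R x + t *\<^sub>R y) = (1 - t) *\<^sub>R (b + x) + t *\<^sub>R (c + y)"
        by (simp add: algebra_simps)
      have "m ((1 - t) *\<^sub>R x + t *\<^sub>R y) \<le> H ?d + g ((1 - t) *\<^sub>R (b + x) + t *\<^sub>R (c + y))"
        using m_le[OF \<open>?d \<in> D\<close>] by (simp only: flip: eq)
      also have "\<dots> \<le> ((1 - t) * H b + t * H c) + ((1 - t) * g (b + x) + t * g (c + y))"
        using t b(1) c(1) by (intro add_mono convex_onD[OF H] convex_onD[OF g(1)]) auto
      also have "\<dots> = (1 - t) * (H b + g (b + x)) + t * (H c + g (c + y))"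
        by (simp add: algebra_simps)
      also have "\<dots> \<le> (1 - t) * (m x + e) + t * (m y + e)"
        using t less_imp_le[OF b(2)] less_imp_le[OF c(2)]
        by (intro add_mono[OF mult_left_mono mult_left_mono]) linarith+
      also have "\<dots> = (1 - t) * m x + t * m y + e"
        by (simp add: algebra_simps)
      finally show "m ((1 - t) *\<^sub>R x + t *\<^sub>R y) \<le> (1 - t) * m x + t * m y + e" .
    qed
  qed simp
  then obtain L where L: "linear L" "\<And>v. m 0 + L v \<le> m v"
    using convex_algebraic_subgradient by blast
  interpret linear L by fact
  have "0 \<le> m 0"
    unfolding m_def using nonneg \<open>D \<noteq> {}\<close> by (intro cINF_greatest) auto
  have key: "m 0 + L x - L b \<le> H b + g x" if "b \<in> D" for b x
    using L(2)[of "x - b"] m_le[OF that, of "x - b"] by (simp add: diff)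
  have "bounded_linear L"
  proof -
    have "isCont g b0"
      using g(2) by (simp add: continuous_on_eq_continuous_at)
    then obtain d where d: "d > 0" "\<And>x. dist x b0 < d \<Longrightarrow> dist (g x) (g b0) < 1"
      unfolding continuous_at_eps_delta by (metis zero_less_one)
    show ?thesis
    proof (rule linear_bounded_above_imp_bounded_linear[OF L(1)])
      show "0 < d / 2" using d by simp
      fix v :: 'v assume "norm v \<le> d / 2"
      then have "dist (b0 + v) b0 < d"
        using d(1) by (simp add: dist_norm)
      from d(2)[OF this] have "g (b0 + v) \<le> g b0 + 1"
        by (simp add: dist_real_def)
      then show "L v \<le> H b0 + g b0 + 1"
        using key[OF b0, of "b0 + v"] \<open>0 \<le> m 0\<close> by (simp add: add)
    qed
  qed
  then have Blin: "blinfun_apply (Blinfun L) = L"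
    by (rule bounded_linear_Blinfun_apply)
  define a where "a = (INF b\<in>D. H b + L b)"
  have bddL: "bdd_below ((\<lambda>b. H b + L b) ` D)"
    by (rule bdd_belowI2[where m = "m 0 + L 0 - g 0"]) (use key[of _ 0] in \<open>auto simp: algebra_simps\<close>)
  show ?thesis
  proof (rule that[of "- Blinfun L" a])
    fix x assume "x \<in> D"
    then show "(- Blinfun L) x + a \<le> H x"
      using cINF_lower[OF bddL, of x] by (simp add: a_def Blin uminus_blinfun.rep_eq)
  next
    fix x
    have "L x - g x \<le> a"
      unfolding a_def
      by (rule cINF_greatest[OF \<open>D \<noteq> {}\<close>]) (use key[of _ x] \<open>0 \<le> m 0\<close> in force)
    then show "0 \<le> (- Blinfun L) x + a + g x"
      by (simp add: Blin uminus_blinfun.rep_eq)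
  qed
qed

section \<open>The duality pairing as a quadratic form\<close>

definition pairing_form ::
  "'a::real_normed_vector \<times> ('a \<Rightarrow>\<^sub>L real) \<Rightarrow> 'a \<times> ('a \<Rightarrow>\<^sub>L real) \<Rightarrow> real" where
  "pairing_form z w = blinfun_apply (snd w) (fst z) + blinfun_apply (snd z) (fst w)"

text \<open>The quadratic form of which \<open>pairing_form\<close> is the polarisation.\<close>

definition pairing :: "'a::real_normed_vector \<times> ('a \<Rightarrow>\<^sub>L real) \<Rightarrow> real" where
  "pairing z = blinfun_apply (snd z) (fst z)"

text \<open>
  The quantity whose infimum over translates decides quasidensity. It is nonnegative, so
  quasidensity says that it can be made arbitrarily small.
\<close>

definition energy :: "'a::real_normed_vector \<times> ('a \<Rightarrow>\<^sub>L real) \<Rightarrow> real" where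
  "energy z = (norm z)\<^sup>2 / 2 + pairing z"

lemma norm_prod_squared:
  "(norm (z :: 'a::real_normed_vector \<times> 'b::real_normed_vector))\<^sup>2
    = (norm (fst z))\<^sup>2 + (norm (snd z))\<^sup>2"
  by (cases z) (simp add: norm_Pair)

lemma pairing_add: "pairing (z + w) = pairing z + pairing w + pairing_form z w"
  by (simp add: pairing_def pairing_form_def blinfun.bilinear_simps)

lemma pairing_diff: "pairing (z - w) = pairing z + pairing w - pairing_form z w"
  by (simp add: pairing_def pairing_form_def blinfun.bilinear_simps)

lemma pairing_scaleR: "pairing (t *\<^sub>R z) = t\<^sup>2 * pairing z"
  by (simp add: pairing_def blinfun.bilinear_simps power2_eq_square)

lemma pairing_form_scaleR:
  "pairing_form (t *\<^sub>R z) w = t * pairing_form z w"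
  "pairing_form z (t *\<^sub>R w) = t * pairing_form z w"
  by (simp_all add: pairing_form_def blinfun.bilinear_simps algebra_simps)

lemma pairing_form_commute: "pairing_form z w = pairing_form w z"
  by (simp add: pairing_form_def)

lemma abs_pairing_form_le:
  fixes z w :: "'a::real_normed_vector \<times> ('a \<Rightarrow>\<^sub>L real)"
  shows "\<bar>pairing_form z w\<bar> \<le> 2 * norm z * norm w"
proof -
  have "\<bar>blinfun_apply (snd w) (fst z)\<bar> \<le> norm w * norm z" for z w :: "'a \<times> ('a \<Rightarrow>\<^sub>L real)"
  proof -
    have "\<bar>blinfun_apply (snd w) (fst z)\<bar> \<le> norm (snd w) * norm (fst z)"
      using norm_blinfun[of "snd w" "fst z"] by simp
    also have "\<dots> \<le> norm w * norm z"
      using norm_snd_le[of "snd w" "fst w"] norm_fst_le[of "fst z" "snd z"]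
      by (intro mult_mono) auto
    finally show ?thesis .
  qed
  from this[of w z] this[of z w] show ?thesis
    by (simp add: pairing_form_def mult.commute)
qed

lemma abs_pairing_le: "\<bar>pairing z\<bar> \<le> (norm z)\<^sup>2 / 2"
proof -
  have "\<bar>pairing z\<bar> \<le> norm (snd z) * norm (fst z)"
    using norm_blinfun[of "snd z" "fst z"] by (simp add: pairing_def)
  also have "\<dots> \<le> (norm z)\<^sup>2 / 2"
    using sum_squares_bound[of "norm (snd z)" "norm (fst z)"] by (simp add: norm_prod_squared)
  finally show ?thesis .
qed

lemma energy_nonneg: "0 \<le> energy z"
  using abs_pairing_le[of z] by (simp add: energy_def)

lemma energy_add_le: "energy (z + w) \<le> energy z + 3 * norm z * norm w + (norm w)\<^sup>2"
proof -
  have "(norm (z + w))\<^sup>2 \<le> (norm z + norm w)\<^sup>2"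
    by (intro power_mono norm_triangle_ineq) auto
  then show ?thesis
    using abs_pairing_le[of w] abs_pairing_form_le[of z w]
    by (simp add: energy_def pairing_add power2_sum)
qed

lemma continuous_on_pairing [continuous_intros]:
  "continuous_on A f \<Longrightarrow> continuous_on A (\<lambda>x. pairing (f x))"
  unfolding pairing_def by (intro blinfun.continuous_on continuous_on_fst continuous_on_snd)

lemma continuous_on_pairing_form [continuous_intros]:
  "continuous_on A f \<Longrightarrow> continuous_on A g \<Longrightarrow> continuous_on A (\<lambda>x. pairing_form (f x) (g x))"
  unfolding pairing_form_def
  by (intro continuous_on_add blinfun.continuous_on continuous_on_fst continuous_on_snd)

section \<open>Approximate touching by duality\<close>

text \<open>
  One half of the fact that \<open>\<parallel>\<cdot>\<parallel>\<^sup>2 / 2\<close> has conjugate \<open>\<parallel>\<cdot>\<parallel>\<^sup>2 / 2\<close>. Optimising along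
  each ray bounds \<open>f x\<close> by \<open>sqrt (- 2 k) \<parallel>x\<parallel>\<close>, which bounds the operator norm.
\<close>

lemma half_square_plus_functional_lower_bound:
  fixes f :: "'v::real_normed_vector \<Rightarrow>\<^sub>L real"
  assumes lower: "\<And>x. k \<le> f x + (norm x)\<^sup>2 / 2"
  shows "k \<le> - ((norm f)\<^sup>2 / 2)"
proof -
  have "k \<le> 0" using lower[of 0] by simp
  have "norm (f x) \<le> sqrt (- 2 * k) * norm x" for x
  proof (cases "x = 0")
    case False
    \<comment> \<open>The minimiser of the quadratic \<open>t f x + t\<^sup>2 \<parallel>x\<parallel>\<^sup>2 / 2\<close>.\<close>
    let ?t = "- f x / (norm x)\<^sup>2"
    have "k \<le> ?t * f x + ?t\<^sup>2 * (norm x)\<^sup>2 / 2"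
      using lower[of "?t *\<^sub>R x"] by (simp add: blinfun.bilinear_simps power_mult_distrib power_divide)
    also have "\<dots> = - ((f x)\<^sup>2 / (norm x)\<^sup>2 / 2)"
      using False by (simp add: field_simps power2_eq_square)
    finally have "(f x)\<^sup>2 \<le> (- 2 * k) * (norm x)\<^sup>2"
      using False by (simp add: field_simps)
    then have "sqrt ((f x)\<^sup>2) \<le> sqrt ((- 2 * k) * (norm x)\<^sup>2)"
      by (rule real_sqrt_le_mono)
    then show ?thesis
      by (simp only: real_sqrt_mult real_sqrt_abs real_norm_def abs_norm_cancel)
  qed (simp add: blinfun.zero_right)
  then have "norm f \<le> sqrt (- 2 * k)"
    using \<open>k \<le> 0\<close> by (intro norm_blinfun_bound) auto
  then have "(norm f)\<^sup>2 \<le> (sqrt (- 2 * k))\<^sup>2"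
    by (rule power_mono) simp
  then show ?thesis using \<open>k \<le> 0\<close> by simp
qed

text \<open>
  Minimising over the two variables separately bounds \<open>k\<close> by \<open>- (\<parallel>u\<parallel>\<^sup>2 + \<parallel>U\<parallel>\<^sup>2) / 2\<close>, which is
  at most \<open>- \<parallel>u\<parallel> \<parallel>U\<parallel>\<close>.
\<close>

lemma half_squares_plus_functionals_lower_bound:
  fixes u :: "'a::real_normed_vector \<Rightarrow>\<^sub>L real" and U :: "('a \<Rightarrow>\<^sub>L real) \<Rightarrow>\<^sub>L real"
  assumes lower: "\<And>x x'. k \<le> u x + U x' + (norm x)\<^sup>2 / 2 + (norm x')\<^sup>2 / 2"
  shows "k \<le> U u"
proof -
  have "k - U x' - (norm x')\<^sup>2 / 2 \<le> - ((norm u)\<^sup>2 / 2)" for x'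
    using lower[of _ x'] by (intro half_square_plus_functional_lower_bound) (simp add: algebra_simps)
  then have "k + (norm u)\<^sup>2 / 2 \<le> - ((norm U)\<^sup>2 / 2)"
    by (intro half_square_plus_functional_lower_bound) (simp add: algebra_simps)
  moreover have "2 * norm U * norm u \<le> (norm U)\<^sup>2 + (norm u)\<^sup>2"
    by (rule sum_squares_bound)
  moreover have "\<bar>U u\<bar> \<le> norm U * norm u"
    using norm_blinfun[of U u] by simp
  ultimately show ?thesis by linarith
qed

lemma convex_on_half_norm_diff_squared:
  "convex_on UNIV (\<lambda>z::'v::real_normed_vector. (norm (z - c))\<^sup>2 / 2)"
proof (rule convex_onI)
  fix t :: real and x y :: 'v
  assume t: "0 < t" "t < 1"
  have "(1 - t) *\<^sub>R x + t *\<^sub>R y - c = (1 - t) *\<^sub>R (x - c) + t *\<^sub>R (y - c)"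
    by (simp add: algebra_simps)
  then have "norm ((1 - t) *\<^sub>R x + t *\<^sub>R y - c) \<le> (1 - t) * norm (x - c) + t * norm (y - c)"
    using t norm_triangle_ineq[of "(1 - t) *\<^sub>R (x - c)" "t *\<^sub>R (y - c)"] by simp
  then have "(norm ((1 - t) *\<^sub>R x + t *\<^sub>R y - c))\<^sup>2 \<le> ((1 - t) * norm (x - c) + t * norm (y - c))\<^sup>2"
    by (rule power_mono) simp
  also have "\<dots> \<le> (1 - t) * (norm (x - c))\<^sup>2 + t * (norm (y - c))\<^sup>2"
    using convex_onD[OF convex_power2, of t "norm (x - c)" "norm (y - c)"] t by simp
  finally show "(norm ((1 - t) *\<^sub>R x + t *\<^sub>R y - c))\<^sup>2 / 2
      \<le> (1 - t) * ((norm (x - c))\<^sup>2 / 2) + t * ((norm (y - c))\<^sup>2 / 2)"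
    by (simp add: field_simps)
qed simp

text \<open>
  The hypothesis on \<open>y'\<close>, \<open>y''\<close>, \<open>k\<close> says that the conjugate of \<open>H\<close> lies above the pairing of
  \<open>E*\<close> with \<open>E**\<close>. If the conclusion failed, then \<open>H\<close> would lie above the concave
  function \<open>- g\<close> of the proof, and \<open>convex_sandwich\<close> would give a functional \<open>(y', y'')\<close> with an affine function in between. The inequality with
  \<open>H\<close> gives \<open>y'' y' \<le> - a\<close>. The inequality with \<open>g\<close>, minimised over all displacements from \<open>c\<close>,
  gives \<open>y'' y' \<ge> e - a\<close>.
\<close>

lemma approximate_touching:
  fixes H :: "'a::real_normed_vector \<times> ('a \<Rightarrow>\<^sub>L real) \<Rightarrow> real"
  assumes H: "convex_on D H" and "D \<noteq> {}"
    and conj: "\<And>(y' :: 'a \<Rightarrow>\<^sub>L real) (y'' :: ('a \<Rightarrow>\<^sub>L real) \<Rightarrow>\<^sub>L real) k.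
      (\<And>x x'. (x, x') \<in> D \<Longrightarrow> blinfun_apply y' x + blinfun_apply y'' x' - H (x, x') \<le> k)
        \<Longrightarrow> blinfun_apply y'' y' \<le> k"
    and "0 < e"
  shows "\<exists>b\<in>D. H b - pairing b + energy (b - c) < e"
proof (rule ccontr)
  assume "\<not> ?thesis"
  then have far: "e \<le> H b - pairing b + energy (b - c)" if "b \<in> D" for b
    using that by fastforce
  \<comment> \<open>The energy of \<open>z - c\<close> minus \<open>pairing z\<close> has no quadratic pairing term, so \<open>g\<close> is convex.\<close>
  define g where "g z = (norm (z - c))\<^sup>2 / 2 + (- pairing_form z c + pairing c - e)" for z
  have "convex_on UNIV (\<lambda>z. - pairing_form z c + pairing c - e)"
    by (rule convex_onI)
      (auto simp: pairing_form_def blinfun.bilinear_simps algebra_simps)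
  then have "convex_on UNIV g"
    unfolding g_def by (rule convex_on_add[OF convex_on_half_norm_diff_squared])
  moreover have "continuous_on UNIV g"
    unfolding g_def by (intro continuous_intros) auto
  moreover have "0 \<le> H b + g b" if "b \<in> D" for b
    using far[OF that] by (simp add: g_def energy_def pairing_diff)
  ultimately obtain L :: "('a \<times> ('a \<Rightarrow>\<^sub>L real)) \<Rightarrow>\<^sub>L real" and a where
    L1: "\<And>z. z \<in> D \<Longrightarrow> L z + a \<le> H z" and L2: "\<And>z. 0 \<le> L z + a + g z"
    using convex_sandwich[OF H \<open>D \<noteq> {}\<close>, of g] by metis
  define y' where "y' = Blinfun (\<lambda>x. L (x, 0))"
  define y'' where "y'' = Blinfun (\<lambda>x'. L (0, x'))"
  have "bounded_linear (\<lambda>x. L (x, 0))"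
    by (rule bounded_linear_compose[OF blinfun.bounded_linear_right
          bounded_linear_Pair[OF bounded_linear_ident bounded_linear_zero]])
  then have y': "y' x = L (x, 0)" for x
    by (simp add: y'_def bounded_linear_Blinfun_apply)
  have "bounded_linear (\<lambda>x'. L (0, x'))"
    by (rule bounded_linear_compose[OF blinfun.bounded_linear_right
          bounded_linear_Pair[OF bounded_linear_zero bounded_linear_ident]])
  then have y'': "y'' x' = L (0, x')" for x'
    by (simp add: y''_def bounded_linear_Blinfun_apply)
  have split: "L (x, x') = y' x + y'' x'" for x x'
    using blinfun.add_right[of L "(x, 0)" "(0, x')"] by (simp add: y' y'')
  have "y'' y' \<le> - a"
  proof (rule conj)
    fix x x' assume "(x, x') \<in> D"
    from L1[OF this] show "y' x + y'' x' - H (x, x') \<le> - a"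
      by (simp add: split)
  qed
  moreover have "e - a + pairing c - L c \<le> (y'' - bidual_embed (fst c)) (y' - snd c)"
  proof (rule half_squares_plus_functionals_lower_bound)
    fix x x'
    have "0 \<le> L (c + (x, x')) + a + g (c + (x, x'))"
      by (rule L2)
    then show "e - a + pairing c - L c \<le> (y' - snd c) x + (y'' - bidual_embed (fst c)) x'
        + (norm x)\<^sup>2 / 2 + (norm x')\<^sup>2 / 2"
      by (simp add: g_def split pairing_def pairing_form_def blinfun.bilinear_simps
          bidual_embed.rep_eq norm_prod_squared add_divide_distrib)
  qed
  ultimately show False
    using \<open>0 < e\<close> split[of "fst c" "snd c"]
    by (simp add: pairing_def blinfun.bilinear_simps bidual_embed.rep_eq)
qed

section \<open>From approximate to exact touching\<close>

text \<open>
  Comparison of \<open>H\<close> with the pairing at the midpoint of \<open>a\<close> and \<open>b\<close>. Combined with a bound on the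
  energy of \<open>a - b\<close>, it controls the norm of \<open>a - b\<close>, which the energy alone does not.
\<close>

lemma minus_pairing_diff_le:
  assumes H: "convex_on D H" and above: "\<And>z. z \<in> D \<Longrightarrow> pairing z \<le> H z"
    and "a \<in> D" "b \<in> D"
  shows "- pairing (a - b) \<le> 2 * ((H a - pairing a) + (H b - pairing b))"
proof -
  let ?c = "(1 - 1/2) *\<^sub>R a + (1/2) *\<^sub>R b"
  have "?c \<in> D"
    by (rule convexD_alt[OF convex_on_imp_convex[OF H] \<open>a \<in> D\<close> \<open>b \<in> D\<close>]) auto
  then have "pairing ?c \<le> H ?c" by (rule above)
  also have "\<dots> \<le> (1 - 1/2) * H a + 1/2 * H b"
    using \<open>a \<in> D\<close> \<open>b \<in> D\<close> by (intro convex_onD[OF H]) auto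
  finally show ?thesis
    by (simp add: pairing_add pairing_diff pairing_scaleR pairing_form_scaleR power2_eq_square)
qed

text \<open>
  On the segment from \<open>X n\<close> to \<open>s\<close>, convexity bounds the pairing by the interpolation of \<open>H\<close>.
  The limit in \<open>n\<close> replaces \<open>H (X n)\<close> by \<open>pairing b\<close>; the value of \<open>H\<close> at \<open>b\<close>, which may lie
  outside \<open>D\<close>, does not occur. The first-order term at \<open>b\<close> along the segment is the claim,
  which says that the conjugate of \<open>H\<close> is at most \<open>pairing b\<close> at \<open>b\<close>.
\<close>

lemma touching_limit:
  assumes H: "convex_on D H" and above: "\<And>z. z \<in> D \<Longrightarrow> pairing z \<le> H z"
    and X: "\<And>n. X n \<in> D" "X \<longlonglongrightarrow> b" "(\<lambda>n. H (X n) - pairing (X n)) \<longlonglongrightarrow> 0"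
    and s: "s \<in> D"
  shows "pairing_form b s - H s \<le> pairing b"
proof -
  have tendsto_pairing: "(\<lambda>n. pairing (Y n)) \<longlonglongrightarrow> pairing y" if "Y \<longlonglongrightarrow> y"
    for Y and y :: "'a \<times> ('a \<Rightarrow>\<^sub>L real)"
    unfolding pairing_def by (intro blinfun.tendsto tendsto_fst tendsto_snd that)
  have HX: "(\<lambda>n. H (X n)) \<longlonglongrightarrow> pairing b"
    using tendsto_add[OF X(3) tendsto_pairing[OF X(2)]] by simp
  have segment: "(1 - t) * (pairing_form b s - pairing b) + t * pairing s \<le> H s"
    if t: "0 < t" "t < 1" for t
  proof -
    have "pairing ((1 - t) *\<^sub>R b + t *\<^sub>R s) \<le> (1 - t) * pairing b + t * H s"
    proof (rule LIMSEQ_le)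
      show "(\<lambda>n. pairing ((1 - t) *\<^sub>R X n + t *\<^sub>R s)) \<longlonglongrightarrow> pairing ((1 - t) *\<^sub>R b + t *\<^sub>R s)"
        by (intro tendsto_pairing tendsto_add tendsto_scaleR tendsto_const X(2))
      show "(\<lambda>n. (1 - t) * H (X n) + t * H s) \<longlonglongrightarrow> (1 - t) * pairing b + t * H s"
        by (intro tendsto_add tendsto_mult tendsto_const HX)
      have "pairing ((1 - t) *\<^sub>R X n + t *\<^sub>R s) \<le> (1 - t) * H (X n) + t * H s" for n
      proof -
        have "(1 - t) *\<^sub>R X n + t *\<^sub>R s \<in> D"
          using t by (intro convexD_alt[OF convex_on_imp_convex[OF H] X(1) s]) auto
        then have "pairing ((1 - t) *\<^sub>R X n + t *\<^sub>R s) \<le> H ((1 - t) *\<^sub>R X n + t *\<^sub>R s)"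
          by (rule above)
        also have "\<dots> \<le> (1 - t) * H (X n) + t * H s"
          using t X(1) s by (intro convex_onD[OF H]) auto
        finally show ?thesis .
      qed
      then show "\<exists>N. \<forall>n\<ge>N. pairing ((1 - t) *\<^sub>R X n + t *\<^sub>R s) \<le> (1 - t) * H (X n) + t * H s"
        by blast
    qed
    moreover have "pairing ((1 - t) *\<^sub>R b + t *\<^sub>R s)
        = (1 - t)\<^sup>2 * pairing b + t\<^sup>2 * pairing s + (1 - t) * (t * pairing_form b s)"
      by (simp add: pairing_add pairing_scaleR pairing_form_scaleR)
    ultimately have "t * ((1 - t) * (pairing_form b s - pairing b) + t * pairing s) \<le> t * H s"
      by (simp add: power2_eq_square algebra_simps)
    then show ?thesis using t by simp
  qed
  have "((\<lambda>t. (1 - t) * (pairing_form b s - pairing b) + t * pairing s)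
      \<longlongrightarrow> (1 - 0) * (pairing_form b s - pairing b) + 0 * pairing s) (at_right 0)"
    by (intro tendsto_intros)
  moreover have "eventually (\<lambda>t. (1 - t) * (pairing_form b s - pairing b) + t * pairing s \<le> H s)
      (at_right 0)"
    using segment by (intro eventually_at_rightI[of 0 1]) auto
  ultimately have "(1 - 0) * (pairing_form b s - pairing b) + 0 * pairing s \<le> H s"
    by (rule tendsto_upperbound) simp
  then show ?thesis by simp
qed

text \<open>
  Iteration of approximate touching around the previous point, with tolerances \<open>d / 4 ^ n\<close>. By
  \<open>minus_pairing_diff_le\<close> the steps have norm at most \<open>sqrt (6 d) / 2 ^ n\<close>, so the iterates
  converge, and \<open>touching_limit\<close> applies to their limit.
\<close>

lemma touching_point_near:
  fixes H :: "'a::banach \<times> ('a \<Rightarrow>\<^sub>L real) \<Rightarrow> real"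
  assumes H: "convex_on D H" and above: "\<And>z. z \<in> D \<Longrightarrow> pairing z \<le> H z"
    and approx: "\<And>c e. 0 < e \<Longrightarrow> \<exists>b\<in>D. H b - pairing b + energy (b - c) < e"
    and b0: "b0 \<in> D" "H b0 - pairing b0 \<le> d" and "0 < d"
  obtains b where "\<And>s. s \<in> D \<Longrightarrow> pairing_form b s - H s \<le> pairing b"
    and "norm (b - b0) \<le> 2 * sqrt (6 * d)"
proof -
  have "\<exists>X. \<forall>n. (X n \<in> D \<and> H (X n) - pairing (X n) \<le> d / 4 ^ n \<and> (n = 0 \<longrightarrow> X n = b0))
      \<and> energy (X (Suc n) - X n) \<le> d / 4 ^ Suc n"
  proof (rule dependent_nat_choice)
    show "\<exists>x. x \<in> D \<and> H x - pairing x \<le> d / 4 ^ 0 \<and> ((0::nat) = 0 \<longrightarrow> x = b0)"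
      using b0 by (intro exI[of _ b0]) simp
  next
    fix x and n :: nat
    have "0 < d / 4 ^ Suc n" using \<open>0 < d\<close> by simp
    from approx[OF this, of x] obtain y
      where y: "y \<in> D" "H y - pairing y + energy (y - x) < d / 4 ^ Suc n" by blast
    then show "\<exists>y. (y \<in> D \<and> H y - pairing y \<le> d / 4 ^ Suc n \<and> (Suc n = 0 \<longrightarrow> y = b0))
        \<and> energy (y - x) \<le> d / 4 ^ Suc n"
      using above[OF y(1)] energy_nonneg[of "y - x"] by (intro exI[of _ y]) auto
  qed
  then obtain X where X: "\<And>n. X n \<in> D" "\<And>n. H (X n) - pairing (X n) \<le> d / 4 ^ n" "X 0 = b0"
    "\<And>n. energy (X (Suc n) - X n) \<le> d / 4 ^ Suc n"
    by blast
  define w where "w n = X (Suc n) - X n" for n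
  have w: "norm (w n) \<le> sqrt (6 * d) * (1/2) ^ n" for n
  proof -
    define E where "E = d / 4 ^ n"
    have "0 < E" using \<open>0 < d\<close> by (simp add: E_def)
    have step: "- pairing (w n)
        \<le> 2 * ((H (X (Suc n)) - pairing (X (Suc n))) + (H (X n) - pairing (X n)))"
      unfolding w_def by (intro minus_pairing_diff_le[OF H] above X(1))
    have quarter: "d / 4 ^ Suc n = E / 4"
      by (simp add: E_def)
    have "H (X (Suc n)) - pairing (X (Suc n)) \<le> E / 4" "H (X n) - pairing (X n) \<le> E"
      "energy (w n) \<le> E / 4"
      using X(2)[of "Suc n"] X(2)[of n] X(4)[of n] unfolding quarter by (simp_all add: E_def w_def)
    then have "(norm (w n))\<^sup>2 \<le> 6 * E"
      using step \<open>0 < E\<close> by (simp add: energy_def)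
    also have "\<dots> = (sqrt (6 * d) * (1/2) ^ n)\<^sup>2"
    proof -
      have "((1/2) ^ n)\<^sup>2 = (1 / 4 ^ n :: real)"
        by (simp add: power_divide power2_eq_square flip: power_mult_distrib)
      moreover have "(sqrt (6 * d))\<^sup>2 = 6 * d"
        using \<open>0 < d\<close> by simp
      ultimately show ?thesis
        by (simp only: power_mult_distrib E_def) simp
    qed
    finally show ?thesis
      by (rule power2_le_imp_le) (use \<open>0 < d\<close> in simp)
  qed
  have geo: "(\<lambda>n. sqrt (6 * d) * (1/2) ^ n) sums (sqrt (6 * d) * 2)"
    using sums_mult[OF geometric_sums[of "1/2 :: real"]] by simp
  have "summable (\<lambda>n. norm (w n))"
    by (rule summable_comparison_test'[OF sums_summable[OF geo], of 0]) (use w in auto)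
  then have "summable w" by (rule summable_norm_cancel)
  define b where "b = b0 + suminf w"
  have "(\<lambda>n. b0 + (\<Sum>i<n. w i)) \<longlonglongrightarrow> b"
    unfolding b_def by (intro tendsto_add tendsto_const summable_LIMSEQ \<open>summable w\<close>)
  moreover have "b0 + (\<Sum>i<n. w i) = X n" for n
    using X(3) by (simp add: w_def sum_lessThan_telescope)
  ultimately have Xb: "X \<longlonglongrightarrow> b" by simp
  have "(\<lambda>n. d * (1/4) ^ n) \<longlonglongrightarrow> d * 0"
    by (intro tendsto_mult tendsto_const LIMSEQ_realpow_zero) auto
  then have zero: "(\<lambda>n. d / 4 ^ n) \<longlonglongrightarrow> 0"
    by (simp add: power_divide)
  have lim: "(\<lambda>n. H (X n) - pairing (X n)) \<longlonglongrightarrow> 0"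
    by (rule tendsto_sandwich[OF always_eventually always_eventually tendsto_const zero])
      (simp_all add: X(2) above[OF X(1)])
  have "pairing_form b s - H s \<le> pairing b" if "s \<in> D" for s
    by (rule touching_limit[OF H above X(1) Xb lim that])
  moreover have "norm (b - b0) \<le> 2 * sqrt (6 * d)"
  proof -
    have "norm (suminf w) \<le> (\<Sum>n. norm (w n))"
      by (rule summable_norm[OF \<open>summable (\<lambda>n. norm (w n))\<close>])
    also have "\<dots> \<le> sqrt (6 * d) * 2"
      using suminf_le[OF w \<open>summable (\<lambda>n. norm (w n))\<close> sums_summable[OF geo]]
      by (simp add: sums_unique[OF geo, symmetric])
    finally show ?thesis by (simp add: b_def mult.commute)
  qed
  ultimately show ?thesis by (rule that)
qed

text \<open>
  A small energy does not bound the norm, but the midpoint comparison with a fixed \<open>a\<close> in \<open>D\<close> does.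
  The bound depends only on \<open>a\<close> and \<open>c\<close>, so it survives the passage to smaller tolerances.
\<close>

lemma approximate_point_bounded:
  assumes H: "convex_on D H" and above: "\<And>z. z \<in> D \<Longrightarrow> pairing z \<le> H z"
    and a: "a \<in> D" and b: "b \<in> D" "H b - pairing b + energy (b - c) \<le> 1"
  shows "norm (b - c) \<le> 1 + (6 + 4 * (H a - pairing a) + (norm (a - c))\<^sup>2) + 4 * norm (a - c)"
proof -
  define z where "z = b - c"
  define e where "e = a - c"
  define P where "P = 6 + 4 * (H a - pairing a) + (norm e)\<^sup>2"
  have "0 \<le> P" using above[OF a] by (simp add: P_def)
  have le1: "H b - pairing b \<le> 1" "energy z \<le> 1"
    using above[OF b(1)] b(2) energy_nonneg[of "b - c"] unfolding z_def by linarith+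
  have "- pairing (z - e) \<le> 2 * ((H b - pairing b) + (H a - pairing a))"
    using minus_pairing_diff_le[OF H above b(1) a] by (simp add: z_def e_def)
  then have "(norm z)\<^sup>2 \<le> P + 4 * norm e * norm z"
    using le1 abs_pairing_le[of e] abs_pairing_form_le[of e z]
    by (simp add: energy_def pairing_diff P_def pairing_form_commute[of z e])
  then have "norm z \<le> 1 + P + 4 * norm e"
  proof (cases "norm z \<le> 1")
    case False
    have "norm z * norm z \<le> P + 4 * norm e * norm z"
      using \<open>(norm z)\<^sup>2 \<le> P + 4 * norm e * norm z\<close> by (simp add: power2_eq_square)
    also have "\<dots> \<le> P * norm z + 4 * norm e * norm z"
      using mult_left_mono[of 1 "norm z" P] False \<open>0 \<le> P\<close> by simp
    also have "\<dots> = (P + 4 * norm e) * norm z"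
      by (simp add: algebra_simps)
    finally have "norm z \<le> P + 4 * norm e"
      by (rule mult_right_le_imp_le) (use False in linarith)
    then show ?thesis by simp
  qed (use \<open>0 \<le> P\<close> in \<open>auto intro: add_increasing2\<close>)
  then show ?thesis by (simp add: z_def e_def P_def)
qed

text \<open>
  The exact touching point lies within \<open>2 sqrt (6 d)\<close> of a point \<open>b0\<close> at which the energy is at
  most \<open>d\<close>. By \<open>energy_add_le\<close> the move costs at most a multiple of \<open>\<parallel>b0 - c\<parallel> sqrt d + d\<close>, which
  tends to zero with \<open>d\<close> because \<open>\<parallel>b0 - c\<parallel>\<close> is bounded uniformly in \<open>d\<close>.
\<close>

lemma touching_point_small_energy:
  fixes H :: "'a::banach \<times> ('a \<Rightarrow>\<^sub>L real) \<Rightarrow> real"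
  assumes H: "convex_on D H" and "D \<noteq> {}" and above: "\<And>z. z \<in> D \<Longrightarrow> pairing z \<le> H z"
    and approx: "\<And>c e. 0 < e \<Longrightarrow> \<exists>b\<in>D. H b - pairing b + energy (b - c) < e"
    and "0 < e"
  obtains b where "\<And>s. s \<in> D \<Longrightarrow> pairing_form b s - H s \<le> pairing b" and "energy (b - c) < e"
proof -
  obtain a where a: "a \<in> D" using \<open>D \<noteq> {}\<close> by auto
  define M where "M = 1 + (6 + 4 * (H a - pairing a) + (norm (a - c))\<^sup>2) + 4 * norm (a - c)"
  let ?r = "\<lambda>d. 2 * sqrt (6 * d)"
  have "((\<lambda>d. d + 3 * M * ?r d + (?r d)\<^sup>2) \<longlongrightarrow> 0 + 3 * M * ?r 0 + (?r 0)\<^sup>2) (at_right 0)"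
    by (intro tendsto_intros)
  then have "\<forall>\<^sub>F d in at_right 0. d + 3 * M * ?r d + (?r d)\<^sup>2 < e"
    using \<open>0 < e\<close> by (auto dest: order_tendstoD(2))
  moreover have "\<forall>\<^sub>F d::real in at_right 0. 0 < d \<and> d < 1"
    by (rule eventually_at_rightI[of 0 1]) auto
  ultimately obtain d where d: "d + 3 * M * ?r d + (?r d)\<^sup>2 < e" "0 < d" "d < 1"
    using eventually_happens'[OF trivial_limit_at_right_real eventually_conj] by blast
  obtain b0 where b0: "b0 \<in> D" "H b0 - pairing b0 + energy (b0 - c) < d"
    using approx[OF d(2)] by blast
  have small: "H b0 - pairing b0 \<le> d" "energy (b0 - c) \<le> d"
    using above[OF b0(1)] b0(2) energy_nonneg[of "b0 - c"] by linarith+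
  obtain b where b: "\<And>s. s \<in> D \<Longrightarrow> pairing_form b s - H s \<le> pairing b"
    and near: "norm (b - b0) \<le> ?r d"
    using touching_point_near[OF H above approx b0(1) small(1) d(2)] by blast
  have M: "norm (b0 - c) \<le> M"
    unfolding M_def using approximate_point_bounded[OF H above a b0(1)] b0(2) d(3) by simp
  have "energy (b - c) = energy ((b0 - c) + (b - b0))"
    by simp
  also have "\<dots> \<le> energy (b0 - c) + 3 * norm (b0 - c) * norm (b - b0) + (norm (b - b0))\<^sup>2"
    by (rule energy_add_le)
  also have "\<dots> \<le> d + 3 * M * ?r d + (?r d)\<^sup>2"
    using small(2) M near order_trans[OF norm_ge_zero M]
    by (intro add_mono mult_mono power_mono) auto
  finally show ?thesis
    using that[OF b] d(1) by simp
qed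

section \<open>The coincidence set of the conjugate\<close>

theorem theorem4p11:
  fixes h :: "'a::banach \<times> ('a \<Rightarrow>\<^sub>L real) \<Rightarrow> ereal"
  assumes nonzero: "\<exists>x::'a. x \<noteq> 0"
    and not_minf: "\<And>z. h z \<noteq> -\<infinity>"
    and "proper_ereal h"
    and "convex_ereal h"
    and "\<And>x x'. h (x, x') \<ge> ereal (blinfun_apply x' x)"
    and "\<And>y' y''. fenchel_conj h (y', y'') \<ge> ereal (blinfun_apply y'' y')"
  shows "(\<forall>x x'. conj_at h (x, x') \<ge> ereal (blinfun_apply x' x)) \<and>
    closed {(x, x'). conj_at h (x, x') = ereal (blinfun_apply x' x)} \<and>
    quasidense {(x, x'). conj_at h (x, x') = ereal (blinfun_apply x' x)}"
proof -
  define D where "D = {z. h z \<noteq> \<infinity>}"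
  define H where "H z = real_of_ereal (h z)" for z
  have hH: "h z = ereal (H z)" if "z \<in> D" for z
    using that not_minf[of z] by (cases "h z") (auto simp: D_def H_def)
  have off_D: "h z = \<infinity>" if "z \<notin> D" for z
    using that by (simp add: D_def)
  have "D \<noteq> {}"
    using \<open>proper_ereal h\<close> unfolding proper_ereal_def D_def by fastforce
  have convex: "(1 - t) *\<^sub>R x + t *\<^sub>R y \<in> D \<and> H ((1 - t) *\<^sub>R x + t *\<^sub>R y) \<le> (1 - t) * H x + t * H y"
    if "0 < t" "t < 1" "x \<in> D" "y \<in> D" for t x y
  proof -
    have "h ((1 - t) *\<^sub>R x + t *\<^sub>R y) \<le> ereal (1 - t) * h x + ereal t * h y"
      using \<open>convex_ereal h\<close> that(1,2) unfolding convex_ereal_def by blast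
    then have le: "h ((1 - t) *\<^sub>R x + t *\<^sub>R y) \<le> ereal ((1 - t) * H x + t * H y)"
      using that by (simp add: hH)
    then have "(1 - t) *\<^sub>R x + t *\<^sub>R y \<in> D"
      by (auto simp: D_def)
    with le show ?thesis by (simp add: hH)
  qed
  have "convex D"
    unfolding convex_alt
  proof (intro ballI allI impI)
    fix x y and t :: real assume "x \<in> D" "y \<in> D" "0 \<le> t \<and> t \<le> 1"
    then show "(1 - t) *\<^sub>R x + t *\<^sub>R y \<in> D"
      using convex[of t x y] by (cases "t = 0 \<or> t = 1") auto
  qed
  then have H: "convex_on D H"
    using convex by (intro convex_onI) auto
  have above: "pairing z \<le> H z" if "z \<in> D" for z
    using assms(5)[where x = "fst z" and x' = "snd z"] hH[OF that] by (simp add: pairing_def)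
  have conj_le: "blinfun_apply y'' y' \<le> k"
    if "\<And>x x'. (x, x') \<in> D \<Longrightarrow> blinfun_apply y' x + blinfun_apply y'' x' - H (x, x') \<le> k"
    for y' :: "'a \<Rightarrow>\<^sub>L real" and y'' :: "('a \<Rightarrow>\<^sub>L real) \<Rightarrow>\<^sub>L real" and k
  proof -
    have "ereal (blinfun_apply y' x + blinfun_apply y'' x') - h (x, x') \<le> ereal k" for x x'
      using that[of x x'] by (cases "(x, x') \<in> D") (auto simp: hH off_D)
    then have "fenchel_conj h (y', y'') \<le> ereal k"
      unfolding fenchel_conj_def by (auto intro!: SUP_least)
    with assms(6)[of y'' y'] have "ereal (blinfun_apply y'' y') \<le> ereal k"
      by (rule order_trans)
    then show ?thesis by simp
  qed
  have approx: "\<exists>b\<in>D. H b - pairing b + energy (b - c) < e" if "0 < e" for c e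
    by (rule approximate_touching[OF H \<open>D \<noteq> {}\<close> conj_le that])
  have conj_at_ge: "ereal (pairing z) \<le> conj_at h z" for z
    using assms(6)[of "bidual_embed (fst z)" "snd z"]
    by (cases z) (simp add: conj_at_def pairing_def bidual_embed.rep_eq)
  have conj_at_pairing_form: "conj_at h z = (SUP s. ereal (pairing_form z s) - h s)" for z
    by (cases z) (simp add: conj_at_eq pairing_form_def case_prod_unfold add.commute)
  define A where "A = {z. conj_at h z = ereal (pairing z)}"
  \<comment> \<open>Since \<open>h\<^sup>@ \<ge> q\<close> everywhere, \<open>A\<close> is \<open>{h\<^sup>@ \<le> q}\<close>, a family of real inequalities.\<close>
  have touching_iff: "z \<in> A \<longleftrightarrow> (\<forall>s\<in>D. pairing_form z s - H s \<le> pairing z)" for z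
  proof -
    have "z \<in> A \<longleftrightarrow> conj_at h z \<le> ereal (pairing z)"
      using conj_at_ge[of z] by (auto simp: A_def)
    also have "\<dots> \<longleftrightarrow> (\<forall>s. ereal (pairing_form z s) - h s \<le> ereal (pairing z))"
      by (simp add: conj_at_pairing_form SUP_le_iff)
    also have "\<dots> \<longleftrightarrow> (\<forall>s\<in>D. pairing_form z s - H s \<le> pairing z)"
    proof -
      have "ereal (pairing_form z s) - h s \<le> ereal (pairing z)
          \<longleftrightarrow> (s \<in> D \<longrightarrow> pairing_form z s - H s \<le> pairing z)" for s
        by (cases "s \<in> D") (simp_all add: hH off_D)
      then show ?thesis by blast
    qed
    finally show ?thesis .
  qed
  have "closed A"
  proof -
    have "A = (\<Inter>s\<in>D. {z. pairing_form z s - H s \<le> pairing z})"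
      using touching_iff by auto
    moreover have "closed {z. pairing_form z s - H s \<le> pairing z}" for s
      by (intro closed_Collect_le continuous_on_diff continuous_on_pairing_form continuous_on_pairing
          continuous_on_id continuous_on_const)
    ultimately show ?thesis by (simp add: closed_INT)
  qed
  moreover have "quasidense A"
    unfolding quasidense_def
  proof (intro allI)
    fix x and x' :: "'a \<Rightarrow>\<^sub>L real"
    let ?f = "\<lambda>(s, s'). ereal (1/2 * (norm (s - x))\<^sup>2 + 1/2 * (norm (s' - x'))\<^sup>2
        + blinfun_apply (s' - x') (s - x))"
    have f: "?f b = ereal (energy (b - (x, x')))" for b
      by (cases b) (simp add: energy_def pairing_def norm_prod_squared add_divide_distrib)
    show "(INF b\<in>A. ?f b) \<le> 0"
    proof (rule ereal_le_epsilon2)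
      fix e :: real assume "0 < e"
      obtain b where b: "\<And>s. s \<in> D \<Longrightarrow> pairing_form b s - H s \<le> pairing b"
        and "energy (b - (x, x')) < e"
        using touching_point_small_energy[OF H \<open>D \<noteq> {}\<close> above approx \<open>0 < e\<close>] by blast
      have "b \<in> A" using b by (simp add: touching_iff)
      then have "(INF b\<in>A. ?f b) \<le> ?f b" by (rule INF_lower)
      also have "\<dots> \<le> 0 + ereal e"
        using \<open>energy (b - (x, x')) < e\<close> by (simp only: f) simp
      finally show "(INF b\<in>A. ?f b) \<le> 0 + ereal e" .
    qed
  qed
  moreover have "A = {(x, x'). conj_at h (x, x') = ereal (blinfun_apply x' x)}"
    by (auto simp: A_def pairing_def)
  ultimately show ?thesis
    using conj_at_ge by (simp add: pairing_def) (metis fst_conv snd_conv)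
qed

end
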